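(* Let $0\le\alpha<1$, and let $f\in\mathcal{S}^{*}(\alpha)$, $h\in\mathcal{K}(\alpha)$ and $g\in\mathcal{R}(\alpha)$. Then $$|H_{3,1}(f)|\le \frac{1}{18}(1-\alpha)^{2}(18-\alpha),$$ $$|H_{3,1}(h)|\le \frac{1}{540}(1-\alpha)^{2}(49-16\alpha),$$ and $$|H_{3,1}(g)|\le \frac{1}{60}(1-\alpha)^{2}\bigl(36-20\alpha+5|1-4\alpha|\bigr).$$
   Context: Let $\mathbb{D}=\{z\in\mathbb{C}:|z|<1\}$ and let $\mathcal{A}$ be the class of functions analytic in $\mathbb{D}$ of the form $f(z)=z+\sum_{k=2}^{\infty}a_kz^k$. For $0\le\alpha<1$: - $\mathcal{S}^{*}(\alpha)$ is the class of $f\in\mathcal{A}$ with $\Re\bigl(zf'(z)/f(z)\bigr)>\alpha$ for all $z\in\mathbb{D}$ (starlike functions of order $\alpha$); - $\mathcal{K}(\alpha)$ is the class of $f\in\mathcal{A}$ with $\Re\bigl(1+zf''(z)/f'(z)\bigr)>\alpha$ for all $z\in\mathbb{D}$ (convex functions of order $\alpha$); - $\mathcal{R}(\alpha)$ is the class of $f\in\mathcal{A}$ with $\Re\bigl(f'(z)\bigr)>\alpha$ for all $z\in\mathbb{D}$ (bounded turning functions of order $\alpha$). For a function $F(z)=\sum_{k\ge 1}a_kz^k$ analytic in $\mathbb{D}$, the third Hankel determinant is $$H_{3,1}(F)=\det\begin{pmatrix} a_1 & a_2 & a_3\\ a_2 & a_3 & a_4\\ a_3 & a_4 & a_5\end{pmatrix};$$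 for $F\in\mathcal{A}$ one has $a_1=1$, so $H_{3,1}(F)=-a_2^2a_5+2a_2a_3a_4-a_3^3+a_3a_5-a_4^2$. *)

theory Defs
  imports "HOL-Complex_Analysis.Complex_Analysis"
begin

definition taylor_coeff :: "(complex \<Rightarrow> complex) \<Rightarrow> nat \<Rightarrow> complex" where
  "taylor_coeff f k = fps_nth (fps_expansion f 0) k"

definition normalized_analytic :: "(complex \<Rightarrow> complex) set" where
  "normalized_analytic =
     {f. f holomorphic_on ball 0 1 \<and> taylor_coeff f 0 = 0 \<and> taylor_coeff f 1 = 1}"

(* The quotient z f'(z) / f(z) has a removable singularity at 0 with value 1, and Re 1 > \<alpha>
   for every \<alpha> < 1; HOL's convention 0 / 0 = 0 would wrongly give 0 there, so the origin is
   excluded.  The conditions f z \<noteq> 0 and (below) deriv f z \<noteq> 0 say that the quotients are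
   defined; the second would not follow from the inequality, as HOL has x / 0 = 0. *)
definition starlike_of_order :: "real \<Rightarrow> (complex \<Rightarrow> complex) set" where
  "starlike_of_order \<alpha> =
     {f \<in> normalized_analytic.
        \<forall>z \<in> ball 0 1 - {0}. f z \<noteq> 0 \<and> Re (z * deriv f z / f z) > \<alpha>}"

definition convex_of_order :: "real \<Rightarrow> (complex \<Rightarrow> complex) set" where
  "convex_of_order \<alpha> =
     {f \<in> normalized_analytic.
        \<forall>z \<in> ball 0 1. deriv f z \<noteq> 0 \<and> Re (1 + z * deriv (deriv f) z / deriv f z) > \<alpha>}"

definition bounded_turning_of_order :: "real \<Rightarrow> (complex \<Rightarrow> complex) set" where
  "bounded_turning_of_order \<alpha> =
     {f \<in> normalized_analytic. \<forall>z \<in> ball 0 1. Re (deriv f z) > \<alpha>}"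

definition hankel31 :: "(complex \<Rightarrow> complex) \<Rightarrow> complex" where
  "hankel31 f = (let a = taylor_coeff f in
     det (vector [vector [a 1, a 2, a 3],
                  vector [a 2, a 3, a 4],
                  vector [a 3, a 4, a 5]] :: complex ^ 3 ^ 3))"

end

theory Submission
  imports Defs
begin

text \<open>
  Write \<open>b = 1 - \<alpha>\<close>. Membership in each class produces a power series \<open>P\<close> with \<open>P(0) = 1\<close> and
  nonnegative real part on the disc. Positivity of its Toeplitz form gives, for every series \<open>Q\<close>,
  a bound on the coefficients of \<open>(P - 1) Q\<close> in terms of the earlier ones; all estimates are instances.

  For starlike \<open>f\<close>, \<open>Q = z / f\<close> gives Clunie's bound \<open>2 b / n\<close> for the coefficients
  \<open>e\<^sub>n\<close> of \<open>z / f\<close>, while \<open>H = e\<^sub>2 e\<^sub>4 - e\<^sub>3\<^sup>2\<close>; this yields the constant 17/18. For convex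
  \<open>h\<close> the same formula for \<open>H\<close> is bounded with \<open>|c\<^sub>n - \<mu> c\<^sub>j c\<^sub>n\<^sub>-\<^sub>j| \<le> 2\<close>, which is
  \<open>Q = 1 - \<mu> c\<^sub>j z\<^sup>j\<close>. For \<open>g\<close> of bounded turning, \<open>H / b\<^sup>2\<close> is affine in \<open>b\<close>, so it suffices to
  treat \<open>b = 0\<close>, where \<open>|c\<^sub>n| \<le> 2\<close> is enough, and \<open>b = 1\<close>, where \<open>H\<close> is expressed by the
  coefficients \<open>w\<^sub>k\<close> of \<open>W = (P - 1) / (P + 1)\<close>; they satisfy \<open>\<Sum> |w\<^sub>k|\<^sup>2 \<le> 1\<close> (\<open>Q = 1 - W\<close>).
\<close>

unbundle no vec_syntax
unbundle fps_syntax

subsection \<open>Toeplitz positivity\<close>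

text \<open>Fourier coefficients of \<open>p\<close> on the circle of radius \<open>r\<close>:
  substituting u = \<open>r * cis t\<close> turns the case \<open>j \<le> k\<close> into Cauchy's
  formula for a derivative at 0, and the case \<open>j > k\<close> into Cauchy's theorem.\<close>

lemma has_integral_circle_fps_nth:
  fixes p :: "complex \<Rightarrow> complex" and r :: real and j k :: nat
  assumes hol: "p holomorphic_on ball 0 1" and exp: "p has_fps_expansion P"
    and r: "0 < r" "r < 1"
  shows "((\<lambda>t. p (r * cis t) * (cis (j * t) * cnj (cis (k * t)))) has_integral
           (if j \<le> k then 2 * pi * (P $ (k - j) * complex_of_real r ^ (k - j)) else 0)) {0..2 * pi}"
proof (cases "j \<le> k")
  case True
  define m where "m = k - j"
  have cis: "cis (j * t) * cnj (cis (k * t)) = inverse (cis t ^ m)" for t :: real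
    using True by (simp add: cis_cnj cis_mult Complex.DeMoivre m_def of_nat_diff algebra_simps)
  have cont: "continuous_on (cball 0 r) p"
    using r by (intro holomorphic_on_imp_continuous_on holomorphic_on_subset[OF hol]) auto
  have "p holomorphic_on ball 0 r"
    using r by (intro holomorphic_on_subset[OF hol]) auto
  from Cauchy_has_contour_integral_higher_derivative_circlepath[OF cont this, of 0 m] r
  have "((\<lambda>u. p u / u ^ Suc m) has_contour_integral (2 * pi * \<i>) * P $ m) (part_circlepath 0 r 0 (2 * pi))"
    by (simp add: circlepath_def fps_nth_fps_expansion[OF exp])
  then have "((\<lambda>t. p (r * cis t) / (r * cis t) ^ Suc m * r * \<i> * cis t) has_integral
      (2 * pi * \<i>) * P $ m) {0..2 * pi}"
    by (subst (asm) has_contour_integral_part_circlepath_iff) (auto simp: mult_ac)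
  from has_integral_mult_right[OF this, of "r ^ m / \<i>"]
  have "((\<lambda>t. r ^ m / \<i> * (p (r * cis t) / (r * cis t) ^ Suc m * r * \<i> * cis t)) has_integral
      2 * pi * (P $ m * r ^ m)) {0..2 * pi}"
    by (simp add: field_simps)
  moreover have "r ^ m / \<i> * (p (r * cis t) / (r * cis t) ^ Suc m * r * \<i> * cis t)
      = p (r * cis t) * (cis (j * t) * cnj (cis (k * t)))" for t :: real
    unfolding cis using r by (simp add: field_simps power_mult_distrib)
  ultimately show ?thesis
    using True by (simp add: m_def)
next
  case False
  \<comment> \<open>Since du = i u dt already supplies one factor u, the contour integrand carries
    one power of u less than \<open>j - k\<close>.\<close>
  define m where "m = j - k - 1"
  have m: "j = Suc (m + k)" using False by (simp add: m_def)
  have cis: "cis (j * t) * cnj (cis (k * t)) = cis t ^ Suc m" for t :: real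
    unfolding cis_cnj cis_mult Complex.DeMoivre m by (simp add: algebra_simps)
  have "((\<lambda>u. p u * u ^ m) has_contour_integral 0) (part_circlepath 0 r 0 (2 * pi))"
  proof (rule Cauchy_theorem_disc_simple[of _ 0 1])
    show "(\<lambda>u. p u * u ^ m) holomorphic_on ball 0 1" by (intro holomorphic_intros hol)
    show "path_image (part_circlepath 0 r 0 (2 * pi)) \<subseteq> ball 0 1"
      using r path_image_circlepath[of 0 r] by (auto simp: circlepath_def)
  qed (auto simp: exp_eq_polar)
  then have "((\<lambda>t. p (r * cis t) * (r * cis t) ^ m * r * \<i> * cis t) has_integral 0) {0..2 * pi}"
    by (subst (asm) has_contour_integral_part_circlepath_iff) (auto simp: mult_ac)
  from has_integral_mult_right[OF this, of "inverse (r ^ Suc m * \<i>)"]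
  have "((\<lambda>t. inverse (r ^ Suc m * \<i>) * (p (r * cis t) * (r * cis t) ^ m * r * \<i> * cis t))
      has_integral 0) {0..2 * pi}"
    by simp
  moreover have "inverse (r ^ Suc m * \<i>) * (p (r * cis t) * (r * cis t) ^ m * r * \<i> * cis t)
      = p (r * cis t) * (cis (j * t) * cnj (cis (k * t)))" for t :: real
    unfolding cis using r by (simp add: field_simps power_mult_distrib)
  ultimately show ?thesis
    using False by simp
qed

lemma Re_mult_of_real: "Re (z * complex_of_real x) = Re z * x"
  by simp

lemma Re_of_real_mult: "Re (complex_of_real x * z) = x * Re z"
  by simp

lemma zero_le_mult_pos:
  fixes a b :: real
  assumes "0 \<le> a * b" "0 < a"
  shows "0 \<le> b"
  using assms by (simp add: zero_le_mult_iff)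

text \<open>Caratheodory's class, attached to the formal series so that the later estimates are
  algebra on coefficients. Given \<open>P $ 0 = 1\<close>, the weak inequality describes the same
  class as the strict one, by the open mapping theorem.\<close>

definition caratheodory :: "complex fps \<Rightarrow> bool" where
  "caratheodory P \<longleftrightarrow> P $ 0 = 1 \<and>
     (\<exists>p. p holomorphic_on ball 0 1 \<and> p has_fps_expansion P \<and> (\<forall>z\<in>ball 0 1. 0 \<le> Re (p z)))"

text \<open>Integrate Re p against the squared modulus of the trigonometric polynomial with
  coefficients \<open>q\<close>. After expanding the square, the pairs with \<open>j > k\<close>
  integrate to 0, which leaves a triangular double sum.\<close>

lemma caratheodory_toeplitz_radius:
  fixes q :: "nat \<Rightarrow> complex" and r :: real
  assumes "caratheodory P" and r: "0 < r" "r < 1"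
  shows "0 \<le> (\<Sum>k\<le>n. Re (cnj (q k) * (\<Sum>j\<le>k. P $ (k - j) * complex_of_real r ^ (k - j) * q j)))"
proof -
  obtain p where hol: "p holomorphic_on ball 0 1" and exp: "p has_fps_expansion P"
    and pos: "\<And>z. z \<in> ball 0 1 \<Longrightarrow> 0 \<le> Re (p z)"
    using assms(1) by (auto simp: caratheodory_def)
  define Q where "Q t = (\<Sum>j\<le>n. q j * cis (j * t))" for t :: real
  define c where "c j k = (if j \<le> k then 2 * pi * (P $ (k - j) * complex_of_real r ^ (k - j)) else 0)" for j k
  have eq: "(\<Sum>k\<le>n. \<Sum>j\<le>n. (cnj (q k) * q j) * (p (r * cis t) * (cis (j * t) * cnj (cis (k * t)))))
      = p (r * cis t) * complex_of_real ((norm (Q t))\<^sup>2)" for t :: real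
  proof -
    have "p (r * cis t) * complex_of_real ((norm (Q t))\<^sup>2) = p (r * cis t) * (Q t * cnj (Q t))"
      by (simp only: complex_norm_square)
    also have "Q t * cnj (Q t) = (\<Sum>j\<le>n. \<Sum>k\<le>n. q j * cis (j * t) * cnj (q k * cis (k * t)))"
      by (simp add: Q_def sum_product)
    also have "\<dots> = (\<Sum>k\<le>n. \<Sum>j\<le>n. q j * cis (j * t) * cnj (q k * cis (k * t)))"
      by (rule sum.swap)
    finally show ?thesis
      by (simp only: sum_distrib_left) (intro sum.cong refl, simp only: complex_cnj_mult, simp only: mult_ac)
  qed
  have "((\<lambda>t. p (r * cis t) * complex_of_real ((norm (Q t))\<^sup>2)) has_integral
      (\<Sum>k\<le>n. \<Sum>j\<le>n. (cnj (q k) * q j) * c j k)) {0..2 * pi}"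
    unfolding eq[symmetric] c_def
    by (rule has_integral_sum[OF finite_atMost] has_integral_mult_right has_integral_circle_fps_nth hol exp r)+
  from has_integral_linear[OF this bounded_linear_Re]
  have int: "((\<lambda>t. Re (p (r * cis t)) * (norm (Q t))\<^sup>2) has_integral
      Re (\<Sum>k\<le>n. \<Sum>j\<le>n. (cnj (q k) * q j) * c j k)) {0..2 * pi}"
    by (simp only: o_def Re_mult_of_real)
  have "0 \<le> Re (\<Sum>k\<le>n. \<Sum>j\<le>n. (cnj (q k) * q j) * c j k)"
    by (rule has_integral_nonneg[OF int]) (intro mult_nonneg_nonneg pos zero_le_power2, use r in \<open>simp add: norm_mult\<close>)
  also have "(\<Sum>k\<le>n. \<Sum>j\<le>n. (cnj (q k) * q j) * c j k)
      = (\<Sum>k\<le>n. of_real (2 * pi) * (cnj (q k) * (\<Sum>j\<le>k. P $ (k - j) * complex_of_real r ^ (k - j) * q j)))"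
  proof (rule sum.cong[OF refl])
    fix k assume "k \<in> {..n}"
    then have "(\<Sum>j\<le>n. (cnj (q k) * q j) * c j k) = (\<Sum>j\<le>k. (cnj (q k) * q j) * c j k)"
      by (intro sum.mono_neutral_right) (auto simp: c_def)
    also have "\<dots>
        = of_real (2 * pi) * (cnj (q k) * (\<Sum>j\<le>k. P $ (k - j) * complex_of_real r ^ (k - j) * q j))"
      unfolding sum_distrib_left by (intro sum.cong refl) (simp add: c_def)
    finally show "(\<Sum>j\<le>n. (cnj (q k) * q j) * c j k)
        = of_real (2 * pi) * (cnj (q k) * (\<Sum>j\<le>k. P $ (k - j) * complex_of_real r ^ (k - j) * q j))" .
  qed
  also have "Re \<dots> = 2 * pi * (\<Sum>k\<le>n. Re (cnj (q k) * (\<Sum>j\<le>k. P $ (k - j) * complex_of_real r ^ (k - j) * q j)))"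
    unfolding Re_sum sum_distrib_left by (intro sum.cong refl) (rule Re_of_real_mult)
  finally show ?thesis
    by (rule zero_le_mult_pos) simp
qed

text \<open>Let the radius tend to 1 in the finite sum. The inner sums become Cauchy products, so
  the coefficients of any formal series \<open>Q\<close> may serve as the vector.\<close>

lemma caratheodory_toeplitz:
  assumes "caratheodory P"
  shows "0 \<le> (\<Sum>k\<le>n. Re (cnj (Q $ k) * (P * Q) $ k))"
proof -
  define F where "F r = (\<Sum>k\<le>n. Re (cnj (Q $ k) * (\<Sum>j\<le>k. P $ (k - j) * complex_of_real r ^ (k - j) * Q $ j)))"
    for r
  have "(F \<longlongrightarrow> F 1) (at_left 1)"
    unfolding F_def by (intro tendsto_intros)
  moreover have "eventually (\<lambda>r. 0 \<le> F r) (at_left (1::real))"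
    using eventually_at_left_real[OF zero_less_one]
    by (rule eventually_mono) (simp only: F_def greaterThanLessThan_iff caratheodory_toeplitz_radius[OF assms])
  ultimately have "0 \<le> F 1"
    by (intro tendsto_lowerbound) auto
  moreover have "(\<Sum>j\<le>k. P $ (k - j) * complex_of_real 1 ^ (k - j) * Q $ j) = (P * Q) $ k" for k
    unfolding mult.commute[of P Q] fps_mult_nth atLeast0AtMost
    by (intro sum.cong refl) (simp add: mult.commute)
  then have "F 1 = (\<Sum>k\<le>n. Re (cnj (Q $ k) * (P * Q) $ k))"
    by (simp only: F_def)
  ultimately show ?thesis by simp
qed

text \<open>Positivity of the Toeplitz form at the vector \<open>Q $ 0, \<dots>, Q $ (n - 1), - U / 2\<close>, where
  \<open>U = ((P - 1) * Q) $ n\<close> does not depend on \<open>Q $ n\<close>.\<close>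

lemma caratheodory_nth_bound:
  assumes P: "caratheodory P"
  shows "(norm (((P - 1) * Q) $ n))\<^sup>2 \<le> 4 * (\<Sum>k<n. Re (cnj (Q $ k) * (P * Q) $ k))"
proof -
  define u where "u = ((P - 1) * Q) $ n"
  \<comment> \<open>With x as last entry, the last term of the form is Re (cnj x * (u + x)). The
    choice x = \<open>- u / 2\<close> minimises it, with value -|u|^2 / 4; hence the factor 4 in the
    bound.\<close>
  define R where "R = Abs_fps (\<lambda>k. if k = n then - u / 2 else Q $ k)"
  have P0: "P $ 0 = 1" using P by (simp add: caratheodory_def)
  have low: "(P * R) $ k = (P * Q) $ k" if "k < n" for k
    using that by (auto simp: fps_mult_nth R_def intro!: sum.cong)
  have "((P - 1) * R) $ n = u"
    unfolding u_def fps_mult_nth by (intro sum.cong refl) (auto simp: R_def P0)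
  then have top: "(P * R) $ n = u / 2"
    by (simp add: left_diff_distrib R_def) (simp add: field_simps)
  have "0 \<le> (\<Sum>k\<le>n. Re (cnj (R $ k) * (P * R) $ k))"
    by (rule caratheodory_toeplitz[OF P])
  also have "\<dots> = (\<Sum>k<n. Re (cnj (Q $ k) * (P * Q) $ k)) + Re (cnj (- u / 2) * (u / 2))"
    unfolding lessThan_Suc_atMost[symmetric] sum.lessThan_Suc top
    by (intro arg_cong2[of _ _ _ _ "(+)"] sum.cong refl) (simp_all only: low lessThan_iff, simp_all add: R_def)
  also have "Re (cnj (- u / 2) * (u / 2)) = - (norm u)\<^sup>2 / 4"
    using cmod_power2[of u] by (simp add: power2_eq_square field_simps)
  finally show ?thesis by (simp add: u_def)
qed

subsection \<open>Coefficient estimates\<close>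

text \<open>The instance \<open>Q = 1\<close>, where only the term \<open>k = 0\<close>
  survives.\<close>

lemma caratheodory_nth_le:
  assumes P: "caratheodory P" and n: "0 < n"
  shows "norm (P $ n) \<le> 2"
proof -
  have "(norm (((P - 1) * 1) $ n))\<^sup>2 \<le> 4 * (\<Sum>k<n. Re (cnj (1 $ k) * (P * 1) $ k))"
    by (rule caratheodory_nth_bound[OF P])
  also have "(\<Sum>k<n. Re (cnj (1 $ k) * (P * 1) $ k)) = (\<Sum>k<n. if k = 0 then 1 else 0)"
    using P by (intro sum.cong) (auto simp: caratheodory_def)
  also have "\<dots> = 1" using n by simp
  finally show ?thesis
    using n by (intro power2_le_imp_le[of "norm (P $ n)" 2]) auto
qed

text \<open>For this \<open>Q\<close> only the indices 0 and \<open>j\<close> contribute: the first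
  gives 1, the second - \<open>\<mu>\<close> (1 - \<open>\<mu>\<close>) |P $ j|^2, which is
  nonpositive for \<open>\<mu>\<close> in [0, 1].\<close>

lemma caratheodory_nth_diff_le:
  fixes \<mu> :: real
  assumes P: "caratheodory P" and j: "0 < j" "j < n" and \<mu>: "0 \<le> \<mu>" "\<mu> \<le> 1"
  shows "norm (P $ n - \<mu> * P $ j * P $ (n - j)) \<le> 2"
proof -
  define Q :: "complex fps" where "Q = 1 - fps_const (\<mu> * P $ j) * fps_X ^ j"
  have PQ: "P * Q = P - fps_const (\<mu> * P $ j) * (P * fps_X ^ j)"
    by (simp add: Q_def algebra_simps)
  have P0: "P $ 0 = 1" using P by (simp add: caratheodory_def)
  have "((P - 1) * Q) $ n = (P * Q) $ n - Q $ n"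
    by (simp add: left_diff_distrib)
  also have "\<dots> = P $ n - \<mu> * P $ j * P $ (n - j)"
    unfolding PQ using j by (simp add: Q_def fps_X_power_mult_right_nth)
  finally have "(norm (P $ n - \<mu> * P $ j * P $ (n - j)))\<^sup>2 \<le> 4 * (\<Sum>k<n. Re (cnj (Q $ k) * (P * Q) $ k))"
    using caratheodory_nth_bound[OF P, of Q n] by simp
  also have "(\<Sum>k<n. Re (cnj (Q $ k) * (P * Q) $ k)) \<le> (\<Sum>k<n. if k = 0 then 1 else 0)"
  proof (rule sum_mono)
    fix k
    consider "k = 0" | "k = j" | "k \<noteq> 0" "k \<noteq> j" by blast
    then show "Re (cnj (Q $ k) * (P * Q) $ k) \<le> (if k = 0 then 1 else 0)"
    proof cases
      case 1
      then show ?thesis using j unfolding PQ by (simp add: Q_def fps_X_power_mult_right_nth P0)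
    next
      case 2
      have "Re (cnj (Q $ k) * (P * Q) $ k) = - (\<mu> * (1 - \<mu>)) * (norm (P $ j))\<^sup>2"
        unfolding PQ using j 2
        by (simp add: Q_def fps_X_power_mult_right_nth P0 cmod_power2)
          (simp add: power2_eq_square algebra_simps)
      also have "\<dots> \<le> 0" using \<mu> by (simp add: mult_nonneg_nonneg mult_nonpos_nonneg)
      finally show ?thesis using 2 j by simp
    next
      case 3
      then show ?thesis by (simp add: Q_def)
    qed
  qed
  also have "(\<Sum>k<n. if k = 0 then 1 else 0 :: real) = 1" using j by simp
  finally show ?thesis
    by (intro power2_le_imp_le[of "norm (P $ n - \<mu> * P $ j * P $ (n - j))" 2]) auto
qed

text \<open>Clunie's coefficient estimate: in the Toeplitz bound for \<open>E\<close> all terms but the first are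
  nonpositive, because \<open>b \<le> 1 \<le> k\<close>.\<close>

lemma caratheodory_log_deriv_nth_le:
  fixes b :: real
  assumes P: "caratheodory P" and b: "0 < b" "b \<le> 1" and E0: "E $ 0 = 1"
    and ode: "fps_const (of_real b) * ((P - 1) * E) = - (fps_X * fps_deriv E)" and n: "0 < n"
  shows "norm (E $ n) \<le> 2 * b / n"
proof -
  have U: "((P - 1) * E) $ k = - of_real (k / b) * E $ k" for k
  proof -
    have "of_real b * ((P - 1) * E) $ k = - (of_nat k * E $ k)"
      using arg_cong[OF ode, of "\<lambda>A. A $ k"] by (cases k) simp_all
    then show ?thesis using b by (simp add: field_simps)
  qed
  \<comment> \<open>The differential equation makes \<open>(P * E) $ k\<close> a real multiple of
    \<open>E $ k\<close>, so the Toeplitz summands are real multiples of |E $ k|^2.\<close>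
  have PE: "(P * E) $ k = of_real (1 - k / b) * E $ k" for k
    using U[of k] by (simp add: left_diff_distrib) (simp add: algebra_simps)
  have "(n / b * norm (E $ n))\<^sup>2 = (norm (((P - 1) * E) $ n))\<^sup>2"
    using b unfolding U by (simp add: norm_mult norm_divide)
  also have "\<dots> \<le> 4 * (\<Sum>k<n. Re (cnj (E $ k) * (P * E) $ k))"
    by (rule caratheodory_nth_bound[OF P])
  also have "(\<Sum>k<n. Re (cnj (E $ k) * (P * E) $ k)) \<le> (\<Sum>k<n. if k = 0 then 1 else 0)"
  proof (rule sum_mono)
    fix k
    have "Re (cnj (E $ k) * (P * E) $ k) = (1 - k / b) * (norm (E $ k))\<^sup>2"
      unfolding PE cmod_power2 by (simp add: power2_eq_square algebra_simps add_divide_distrib)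
    also have "\<dots> \<le> (if k = 0 then 1 else 0)"
    proof (cases "k = 0")
      case False
      then have "1 - k / b \<le> 0" using b by (simp add: field_simps)
      then show ?thesis using False by (simp add: mult_nonpos_nonneg)
    qed (simp add: E0)
    finally show "Re (cnj (E $ k) * (P * E) $ k) \<le> (if k = 0 then 1 else 0)" .
  qed
  also have "(\<Sum>k<n. if k = 0 then 1 else 0 :: real) = 1" using n by simp
  finally have "n / b * norm (E $ n) \<le> 2"
    by (intro power2_le_imp_le[of "n / b * norm (E $ n)" 2]) auto
  then show ?thesis using b n by (simp add: field_simps)
qed

text \<open>\<open>W\<close> is the Schwarz function of \<open>P\<close>. For
  \<open>Q = 1 - W\<close> one has \<open>P * Q = 1 + W\<close> and (P - 1) Q = 2 W, so the Toeplitz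
  bound reads |2 w_n|^2 \<le> 4 (1 - |w_1|^2 - ... - |w_(n-1)|^2).\<close>

lemma caratheodory_cayley_sum_le:
  assumes P: "caratheodory P" and W: "P - 1 = W * (P + 1)"
  shows "(\<Sum>k=1..n. (norm (W $ k))\<^sup>2) \<le> 1"
proof (cases n)
  case (Suc m)
  have P0: "P $ 0 = 1" using P by (simp add: caratheodory_def)
  have W0: "W $ 0 = 0" using arg_cong[OF W, of "\<lambda>A. A $ 0"] P0 by simp
  have PQ: "P * (1 - W) = 1 + W" using W by (simp add: algebra_simps)
  have "(P - 1) * (1 - W) = fps_const 2 * W"
    using W by (simp add: algebra_simps numeral_fps_const[symmetric])
  then have "(norm (2 * W $ n))\<^sup>2 \<le> 4 * (\<Sum>k<n. Re (cnj ((1 - W) $ k) * (1 + W) $ k))"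
    using caratheodory_nth_bound[OF P, of "1 - W" n] unfolding PQ by simp
  moreover have "(\<Sum>k<n. Re (cnj ((1 - W) $ k) * (1 + W) $ k))
      = 1 - (\<Sum>k\<in>{1..<n}. (norm (W $ k))\<^sup>2)"
  proof -
    have "{..<n} = insert 0 {1..<n}" using Suc by auto
    moreover have "Re (cnj ((1 - W) $ k) * (1 + W) $ k) = - (norm (W $ k))\<^sup>2" if "k \<in> {1..<n}" for k
      using that unfolding cmod_power2 by (simp add: power2_eq_square)
    ultimately show ?thesis by (simp add: W0 sum_negf)
  qed
  moreover have "(\<Sum>k=1..n. (norm (W $ k))\<^sup>2) = (\<Sum>k\<in>{1..<n}. (norm (W $ k))\<^sup>2) + (norm (W $ n))\<^sup>2"
    using Suc by (simp add: atLeastLessThanSuc_atLeastAtMost[symmetric])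
  ultimately show ?thesis by (simp add: norm_mult power_mult_distrib)
qed simp

subsection \<open>Bounds on the Hankel determinant of a power series\<close>

definition hankel31_fps :: "complex fps \<Rightarrow> complex" where
  "hankel31_fps F = F $ 1 * (F $ 3 * F $ 5 - (F $ 4)\<^sup>2) - F $ 2 * (F $ 2 * F $ 5 - F $ 3 * F $ 4)
     + F $ 3 * (F $ 2 * F $ 4 - (F $ 3)\<^sup>2)"

lemma hankel31_eq: "hankel31 f = hankel31_fps (fps_expansion f 0)"
  by (simp add: hankel31_def hankel31_fps_def taylor_coeff_def det_3 Let_def power2_eq_square algebra_simps)

lemma fps_mult_nth_upto_4:
  fixes A B :: "'a :: comm_ring_1 fps"
  shows "(A * B) $ 2 = A $ 0 * B $ 2 + A $ 1 * B $ 1 + A $ 2 * B $ 0"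
    and "(A * B) $ 3 = A $ 0 * B $ 3 + A $ 1 * B $ 2 + A $ 2 * B $ 1 + A $ 3 * B $ 0"
    and "(A * B) $ 4 = A $ 0 * B $ 4 + A $ 1 * B $ 3 + A $ 2 * B $ 2 + A $ 3 * B $ 1 + A $ 4 * B $ 0"
  by (simp_all add: fps_mult_nth eval_nat_numeral sum.atLeast0_atMost_Suc)

text \<open>The hypothesis \<open>ode\<close> is b (P - 1) = z F' / F - 1 cleared of its
  denominator. Passing to the reciprocal of F / z simplifies both this equation and the
  determinant.\<close>

lemma hankel31_starlike_fps:
  fixes b :: real
  assumes P: "caratheodory P" and b: "0 < b" "b \<le> 1" and F: "F $ 0 = 0" "F $ 1 = 1"
    and ode: "fps_const (of_real b) * ((P - 1) * F) = fps_X * fps_deriv F - F"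
  shows "norm (hankel31_fps F) \<le> 17 / 18 * b\<^sup>2"
proof -
  define G where "G = fps_shift 1 F"
  define E where "E = inverse G"
  have G0: "G $ 0 = 1" using F by (simp add: G_def)
  have FG: "F = fps_X * G"
    by (rule fps_ext) (use F in \<open>auto simp: G_def\<close>)
  have "fps_X * (fps_const (of_real b) * ((P - 1) * G)) = fps_X * (fps_X * fps_deriv G)"
    using ode unfolding FG by (simp add: algebra_simps)
  then have odeG: "fps_const (of_real b) * ((P - 1) * G) = fps_X * fps_deriv G"
    by (simp add: mult_cancel_left)
  have GE: "G * E = 1" unfolding E_def using G0 by (simp add: inverse_mult_eq_1')
  \<comment> \<open>The logarithmic derivatives of \<open>G\<close> and its reciprocal
    \<open>E\<close> are opposite, so the equation for \<open>E\<close> differs only by a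
    sign.\<close>
  have "fps_const (of_real b) * ((P - 1) * E) = fps_const (of_real b) * ((P - 1) * G) * E * E"
    using GE by (metis (no_types, lifting) mult.assoc mult.commute mult.left_commute mult_1)
  also have "\<dots> = - (fps_X * fps_deriv E)"
    unfolding odeG E_def using G0 by (simp add: fps_inverse_deriv power2_eq_square algebra_simps)
  finally have odeE: "fps_const (of_real b) * ((P - 1) * E) = - (fps_X * fps_deriv E)" .
  have E0: "E $ 0 = 1" using G0 by (simp add: E_def)
  have e: "norm (E $ n) \<le> 2 * b / n" if "0 < n" for n
    by (rule caratheodory_log_deriv_nth_le[OF P b E0 odeE that])
  have G: "G $ 1 = F $ 2" "G $ 2 = F $ 3" "G $ 3 = F $ 4" "G $ 4 = F $ 5"
    by (simp_all add: G_def eval_nat_numeral)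
  have "(G * E) $ 1 = 0" "(G * E) $ 2 = 0" "(G * E) $ 3 = 0" "(G * E) $ 4 = 0"
    unfolding GE by simp_all
  then have E: "F $ 2 + E $ 1 = 0" "F $ 3 + F $ 2 * E $ 1 + E $ 2 = 0"
      "F $ 4 + F $ 3 * E $ 1 + F $ 2 * E $ 2 + E $ 3 = 0"
      "F $ 5 + F $ 4 * E $ 1 + F $ 3 * E $ 2 + F $ 2 * E $ 3 + E $ 4 = 0"
    unfolding fps_mult_nth_upto_4 fps_mult_nth_1 G G0 E0 by (simp_all add: algebra_simps)
  have F2: "F $ 2 = - E $ 1" using E(1) by (simp add: add_eq_0_iff2)
  have F3: "F $ 3 = - (F $ 2 * E $ 1 + E $ 2)" using E(2) by algebra
  have F4: "F $ 4 = - (F $ 3 * E $ 1 + F $ 2 * E $ 2 + E $ 3)" using E(3) by algebra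
  have F5: "F $ 5 = - (F $ 4 * E $ 1 + F $ 3 * E $ 2 + F $ 2 * E $ 3 + E $ 4)" using E(4) by algebra
  \<comment> \<open>In terms of the reciprocal the 3 by 3 determinant collapses to a 2 by 2 one;
    \<open>E $ 1\<close> cancels.\<close>
  have "hankel31_fps F = E $ 2 * E $ 4 - (E $ 3)\<^sup>2"
    unfolding hankel31_fps_def F(2) F5 F4 F3 F2 by (simp add: algebra_simps power2_eq_square)
  also have "norm \<dots> \<le> norm (E $ 2) * norm (E $ 4) + (norm (E $ 3))\<^sup>2"
    by (metis norm_triangle_ineq4 norm_mult norm_power)
  also have "\<dots> \<le> (2 * b / 2) * (2 * b / 4) + (2 * b / 3)\<^sup>2"
    using e[of 2] e[of 3] e[of 4] b by (intro add_mono mult_mono power_mono) auto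
  also have "\<dots> = 17 / 18 * b\<^sup>2" by (simp add: power2_eq_square)
  finally show ?thesis .
qed

lemma hankel31_convex_fps:
  fixes b :: real
  assumes P: "caratheodory P" and b: "0 < b" "b \<le> 1" and F: "F $ 1 = 1"
    and ode: "fps_const (of_real b) * ((P - 1) * fps_deriv F) = fps_X * fps_deriv (fps_deriv F)"
  shows "norm (hankel31_fps F) \<le> (33 + 14 * b) / 540 * b\<^sup>2"
proof -
  define c where "c n = P $ n" for n
  have P0: "P $ 0 = 1" using P by (simp add: caratheodory_def)
  have c: "norm (c n) \<le> 2" if "0 < n" for n
    unfolding c_def by (rule caratheodory_nth_le[OF P that])
  define B where "B = complex_of_real b"
  have ode': "B * ((P - 1) * fps_deriv F) $ n = (fps_X * fps_deriv (fps_deriv F)) $ n" for n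
    using arg_cong[OF ode, of "\<lambda>A. A $ n"] by (simp add: B_def)
  have F2: "F $ 2 = B * c 1 / 2"
    using ode'[of 1] F P0 unfolding fps_mult_nth_1 by (simp add: c_def numeral_2_eq_2)
  have F3: "F $ 3 = B * (c 2 + 2 * F $ 2 * c 1) / 6"
    using ode'[of 2] F P0 unfolding fps_mult_nth_upto_4 by (simp add: c_def eval_nat_numeral) (simp add: algebra_simps)
  have F4: "F $ 4 = B * (c 3 + 2 * F $ 2 * c 2 + 3 * F $ 3 * c 1) / 12"
    using ode'[of 3] F P0 unfolding fps_mult_nth_upto_4 by (simp add: c_def eval_nat_numeral) (simp add: algebra_simps)
  have F5: "F $ 5 = B * (c 4 + 2 * F $ 2 * c 3 + 3 * F $ 3 * c 2 + 4 * F $ 4 * c 1) / 20"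
    using ode'[of 4] F P0 unfolding fps_mult_nth_upto_4 by (simp add: c_def eval_nat_numeral) (simp add: algebra_simps)
  \<comment> \<open>\<open>- B * X / 6\<close>, \<open>- B * Z / 12\<close> and \<open>- B * (18 * Y - B * R) / 360\<close> are the coefficients of
    index 2, 3 and 4 of the reciprocal of \<open>h(z) / z\<close>.\<close>
  define X where "X = c 2 - B / 2 * c 1 * c 1"
  define Z where "Z = c 3 - B / 2 * c 1 * c 2"
  define Y where "Y = c 4 - B / 3 * c 1 * c 3"
  define R where "R = (c 2)\<^sup>2 + 2 * B * (c 1)\<^sup>2 * c 2 - B\<^sup>2 / 2 * (c 1) ^ 4"
  \<comment> \<open>This is the reciprocal-series formula of the starlike case. \<open>X\<close>,
    \<open>Z\<close> and \<open>Y\<close> have the shape c_n - \<open>\<mu>\<close> c_1 c_(n-1) with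
    \<open>\<mu>\<close> = b/2, b/2, b/3, hence norm at most 2; the remainder \<open>R\<close> is
    estimated termwise by 4 + 16 + 8 = 28.\<close>
  have "hankel31_fps F = B\<^sup>2 * (X / 6 * ((18 * Y - B * R) / 360) - (Z / 12)\<^sup>2)"
    unfolding hankel31_fps_def F F5 F4 F3 F2 X_def Y_def Z_def R_def
    by (simp add: field_simps power2_eq_square power4_eq_xxxx)
  then have "norm (hankel31_fps F) = b\<^sup>2 * norm (X / 6 * ((18 * Y - B * R) / 360) - (Z / 12)\<^sup>2)"
    by (simp add: norm_mult norm_power B_def)
  also have "norm (X / 6 * ((18 * Y - B * R) / 360) - (Z / 12)\<^sup>2)
      \<le> norm (X / 6) * norm ((18 * Y - B * R) / 360) + (norm (Z / 12))\<^sup>2"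
    by (metis norm_triangle_ineq4 norm_mult norm_power)
  also have "\<dots> \<le> 2 / 6 * ((36 + 28 * b) / 360) + (2 / 12)\<^sup>2"
  proof (intro add_mono mult_mono power_mono)
    show "norm (X / 6) \<le> 2 / 6"
      using caratheodory_nth_diff_le[OF P, of 1 2 "b / 2"] b by (simp add: X_def c_def B_def norm_divide)
    show "norm (Z / 12) \<le> 2 / 12"
      using caratheodory_nth_diff_le[OF P, of 1 3 "b / 2"] b by (simp add: Z_def c_def B_def norm_divide)
    have Y: "norm Y \<le> 2"
      using caratheodory_nth_diff_le[OF P, of 1 4 "b / 3"] b by (simp add: Y_def c_def B_def)
    have "norm R \<le> norm ((c 2)\<^sup>2) + norm (2 * B * (c 1)\<^sup>2 * c 2) + norm (B\<^sup>2 / 2 * (c 1) ^ 4)"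
      unfolding R_def by (meson add_mono_thms_linordered_semiring(3) norm_triangle_ineq norm_triangle_ineq4 order_trans)
    also have "\<dots> = (norm (c 2))\<^sup>2 + 2 * b * (norm (c 1))\<^sup>2 * norm (c 2) + b\<^sup>2 / 2 * (norm (c 1)) ^ 4"
      using b by (simp add: norm_mult norm_power norm_divide B_def)
    also have "\<dots> \<le> 2\<^sup>2 + 2 * 1 * 2\<^sup>2 * 2 + 1\<^sup>2 / 2 * 2 ^ 4"
      using b c[of 1] c[of 2] by (intro add_mono mult_mono power_mono divide_right_mono) auto
    finally have "norm R \<le> 28" by simp
    then have "b * norm R \<le> b * 28" using b by (intro mult_left_mono) auto
    moreover have "norm (18 * Y - B * R) \<le> 18 * norm Y + b * norm R"
      using norm_triangle_ineq4[of "18 * Y" "B * R"] b by (simp add: norm_mult B_def)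
    ultimately show "norm ((18 * Y - B * R) / 360) \<le> (36 + 28 * b) / 360"
      using Y by (simp add: norm_divide)
  qed (use b in auto)
  also have "\<dots> = (33 + 14 * b) / 540" by (simp add: field_simps power2_eq_square)
  finally show ?thesis using b by (simp add: mult_left_mono mult.commute)
qed

text \<open>Since \<open>x1\<close> and \<open>x2\<close> are at most 1, every monomial is dominated
  by a quadratic one, and 2 x y \<le> x^2 + y^2 removes the mixed products. The squares of
  \<open>x1\<close>, ..., \<open>x4\<close> then carry 136, 148, 216 and 108, all at most
  216.\<close>

lemma schwarz_hankel_estimate:
  fixes x1 x2 x3 x4 :: real
  assumes pos: "0 \<le> x1" "0 \<le> x2" "0 \<le> x3" "0 \<le> x4"
    and sum: "x1\<^sup>2 + x2\<^sup>2 + x3\<^sup>2 + x4\<^sup>2 \<le> 1"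
  shows "144 * (x2 * x4) + 72 * (x1\<^sup>2 * x4) + 135 * x3\<^sup>2 + 108 * (x1 * x2 * x3) + 54 * (x1 ^ 3 * x3)
    + 16 * x2 ^ 3 + 60 * (x1\<^sup>2 * x2\<^sup>2) + 12 * (x1 ^ 4 * x2) + 7 * x1 ^ 6 \<le> 216"
proof -
  have sq: "0 \<le> x1\<^sup>2" "0 \<le> x2\<^sup>2" "0 \<le> x3\<^sup>2" "0 \<le> x4\<^sup>2" by simp_all
  have "x1\<^sup>2 \<le> 1" using sq sum by linarith
  then have le1: "x1 \<le> 1" by (simp add: power_le_one_iff abs_square_le_1 pos abs_le_iff)
  have "x2\<^sup>2 \<le> 1" using sq sum by linarith
  then have le2: "x2 \<le> 1" by (simp add: power_le_one_iff abs_square_le_1 pos abs_le_iff)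
  have amgm: "2 * (x * y) \<le> x\<^sup>2 + y\<^sup>2" for x y :: real
    using sum_squares_bound[of x y] by simp
  have pw: "x1 ^ Suc n \<le> x1" for n
    using power_decreasing[of 1 "Suc n" x1] le1 pos by simp
  have "x1\<^sup>2 * x4 \<le> x1 * x4" "x1 ^ 3 * x3 \<le> x1 * x3" "x1 ^ 4 * x2 \<le> x1 * x2"
    using pw[of 1] pw[of 2] pw[of 3] pos by (auto intro!: mult_right_mono simp: eval_nat_numeral)
  moreover have "x1 * x2 * x3 \<le> x2 * x3"
    using mult_right_mono[OF le1, of "x2 * x3"] pos by (simp add: mult_ac)
  moreover have "x2 ^ 3 \<le> x2\<^sup>2" "x1 ^ 6 \<le> x1\<^sup>2"
    using le1 le2 pos by (auto intro: power_decreasing)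
  moreover have "x1\<^sup>2 * x2\<^sup>2 \<le> x1\<^sup>2"
    using le1 le2 pos by (simp add: mult_left_le power_le_one)
  ultimately show ?thesis
    using amgm[of x2 x4] amgm[of x1 x4] amgm[of x2 x3] amgm[of x1 x3] amgm[of x1 x2] sum sq by linarith
qed

lemma hankel31_bounded_turning_fps:
  fixes b :: real
  assumes P: "caratheodory P" and b: "0 \<le> b" "b \<le> 1"
    and ode: "fps_deriv F = 1 + fps_const (of_real b) * (P - 1)"
  shows "norm (hankel31_fps F) \<le> 31 / 60 * b\<^sup>2"
proof -
  define c where "c n = P $ n" for n
  have P0: "P $ 0 = 1" using P by (simp add: caratheodory_def)
  have c: "norm (c n) \<le> 2" if "0 < n" for n
    unfolding c_def by (rule caratheodory_nth_le[OF P that])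
  define B where "B = complex_of_real b"
  have F: "of_nat (Suc n) * F $ Suc n = (if n = 0 then 1 else B * c n)" for n
    using arg_cong[OF ode, of "\<lambda>A. A $ n"] P0 by (simp add: B_def c_def)
  have F15: "F $ 1 = 1" "F $ 2 = B * c 1 / 2" "F $ 3 = B * c 2 / 3" "F $ 4 = B * c 3 / 4" "F $ 5 = B * c 4 / 5"
    using F[of 0] F[of 1] F[of 2] F[of 3] F[of 4] by (simp_all add: eval_nat_numeral field_simps)
  \<comment> \<open>2160 is the least common denominator of the determinant's terms.
    \<open>S0\<close> and \<open>S1\<close> are the values of 2160 H / b^2 at b = 0 and b = 1, so a
    common bound for both passes to every b in [0, 1].\<close>
  define S0 where "S0 = 144 * c 2 * c 4 - 135 * (c 3)\<^sup>2"
  define S1 where "S1 = S0 - 108 * (c 1)\<^sup>2 * c 4 + 180 * c 1 * c 2 * c 3 - 80 * (c 2) ^ 3"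
  have "2160 * hankel31_fps F = B\<^sup>2 * (of_real (1 - b) * S0 + of_real b * S1)"
    unfolding hankel31_fps_def F15 S1_def S0_def
    by (simp add: field_simps power2_eq_square power3_eq_cube B_def)
  then have "norm (2160 * hankel31_fps F) = norm (B\<^sup>2 * (of_real (1 - b) * S0 + of_real b * S1))"
    by (rule arg_cong)
  then have eq: "2160 * norm (hankel31_fps F) = b\<^sup>2 * norm (of_real (1 - b) * S0 + of_real b * S1)"
    by (simp only: norm_mult norm_power B_def norm_of_real power2_abs norm_numeral)
  have "norm S0 \<le> norm (144 * c 2 * c 4) + norm (135 * (c 3)\<^sup>2)"
    unfolding S0_def by (rule norm_triangle_ineq4)
  also have "\<dots> = 144 * norm (c 2) * norm (c 4) + 135 * (norm (c 3))\<^sup>2"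
    by (simp add: norm_mult norm_power)
  also have "\<dots> \<le> 144 * 2 * 2 + 135 * 2\<^sup>2"
    using c[of 2] c[of 3] c[of 4] by (intro add_mono mult_mono power_mono) auto
  finally have S0: "norm S0 \<le> 1116" by simp
  define W where "W = (P - 1) * inverse (P + 1)"
  have W: "P - 1 = W * (P + 1)"
    unfolding W_def using P0 by (simp add: mult.assoc inverse_mult_eq_1)
  define w where "w n = W $ n" for n
  have w0: "W $ 0 = 0" using P0 by (simp add: W_def)
  have c1: "c 1 = 2 * w 1"
    using arg_cong[OF W, of "\<lambda>A. A $ 1"] P0 w0 unfolding fps_mult_nth_1 by (simp add: c_def w_def)
  have c2: "c 2 = 2 * w 2 + w 1 * c 1"
    using arg_cong[OF W, of "\<lambda>A. A $ 2"] P0 w0 unfolding fps_mult_nth_upto_4 by (simp add: c_def w_def algebra_simps)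
  have c3: "c 3 = 2 * w 3 + w 2 * c 1 + w 1 * c 2"
    using arg_cong[OF W, of "\<lambda>A. A $ 3"] P0 w0 unfolding fps_mult_nth_upto_4 by (simp add: c_def w_def algebra_simps)
  have c4: "c 4 = 2 * w 4 + w 3 * c 1 + w 2 * c 2 + w 1 * c 3"
    using arg_cong[OF W, of "\<lambda>A. A $ 4"] P0 w0 unfolding fps_mult_nth_upto_4 by (simp add: c_def w_def algebra_simps)
  \<comment> \<open>In the coefficients of \<open>W\<close> the triangle inequality loses little
    enough: it gives 864, below the bound 1116 for \<open>S0\<close>.\<close>
  have "S1 = 4 * (144 * (w 2 * w 4) - 72 * ((w 1)\<^sup>2 * w 4) - 135 * (w 3)\<^sup>2 + 108 * (w 1 * w 2 * w 3)
      - 54 * ((w 1) ^ 3 * w 3) - 16 * (w 2) ^ 3 + 60 * ((w 1)\<^sup>2 * (w 2)\<^sup>2) - 12 * ((w 1) ^ 4 * w 2) - 7 * (w 1) ^ 6)"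
    unfolding S1_def S0_def c4 c3 c2 c1 by algebra
  then have "norm S1 = 4 * norm (144 * (w 2 * w 4) - 72 * ((w 1)\<^sup>2 * w 4) - 135 * (w 3)\<^sup>2 + 108 * (w 1 * w 2 * w 3)
      - 54 * ((w 1) ^ 3 * w 3) - 16 * (w 2) ^ 3 + 60 * ((w 1)\<^sup>2 * (w 2)\<^sup>2) - 12 * ((w 1) ^ 4 * w 2) - 7 * (w 1) ^ 6)"
    by (simp only: norm_mult norm_numeral)
  also have "\<dots> \<le> 4 * (norm (144 * (w 2 * w 4)) + norm (72 * ((w 1)\<^sup>2 * w 4)) + norm (135 * (w 3)\<^sup>2)
      + norm (108 * (w 1 * w 2 * w 3)) + norm (54 * ((w 1) ^ 3 * w 3)) + norm (16 * (w 2) ^ 3)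
      + norm (60 * ((w 1)\<^sup>2 * (w 2)\<^sup>2)) + norm (12 * ((w 1) ^ 4 * w 2)) + norm (7 * (w 1) ^ 6))"
    by (intro mult_left_mono order_trans[OF norm_triangle_ineq4 add_right_mono]
        order_trans[OF norm_triangle_ineq add_right_mono] order_refl) simp
  also have "\<dots> = 4 * (144 * (norm (w 2) * norm (w 4)) + 72 * ((norm (w 1))\<^sup>2 * norm (w 4)) + 135 * (norm (w 3))\<^sup>2
      + 108 * (norm (w 1) * norm (w 2) * norm (w 3)) + 54 * (norm (w 1) ^ 3 * norm (w 3)) + 16 * norm (w 2) ^ 3
      + 60 * ((norm (w 1))\<^sup>2 * (norm (w 2))\<^sup>2) + 12 * (norm (w 1) ^ 4 * norm (w 2)) + 7 * norm (w 1) ^ 6)"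
    by (simp add: norm_mult norm_power)
  also have "\<dots> \<le> 4 * 216"
  proof (intro mult_left_mono schwarz_hankel_estimate)
    show "(norm (w 1))\<^sup>2 + (norm (w 2))\<^sup>2 + (norm (w 3))\<^sup>2 + (norm (w 4))\<^sup>2 \<le> 1"
      using caratheodory_cayley_sum_le[OF P W, of 4] by (simp add: w_def eval_nat_numeral)
  qed simp_all
  finally have S1: "norm S1 \<le> 1116" by simp
  have "norm (of_real (1 - b) * S0 + of_real b * S1) \<le> norm (of_real (1 - b) * S0) + norm (of_real b * S1)"
    by (rule norm_triangle_ineq)
  also have "\<dots> = (1 - b) * norm S0 + b * norm S1"
    using b by (simp only: norm_mult norm_of_real)
  also have "\<dots> \<le> (1 - b) * 1116 + b * 1116"
    using S0 S1 b by (intro add_mono mult_left_mono) auto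
  finally have "b\<^sup>2 * norm (of_real (1 - b) * S0 + of_real b * S1) \<le> b\<^sup>2 * 1116"
    by (intro mult_left_mono) simp_all
  then show ?thesis using eq by simp
qed

subsection \<open>From analytic functions to power series\<close>

lemma normalized_analytic_fps:
  assumes "f \<in> normalized_analytic"
  shows "f has_fps_expansion fps_expansion f 0" "fps_expansion f 0 $ 0 = 0" "fps_expansion f 0 $ 1 = 1"
  using assms has_fps_expansion_fps_expansion[of "ball 0 1" f]
  by (simp_all add: normalized_analytic_def taylor_coeff_def)

lemma Re_add_divide_of_real: "Re (1 + 1 / complex_of_real r * z) = 1 + Re z / r"
  by simp

text \<open>With q = z f' / f, the affine map 1 + (q - 1) / (1 - \<open>\<alpha>\<close>) sends Re q
  > \<open>\<alpha>\<close> into the right half plane and fixes 1. The difficulty is the removable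
  singularity of q at 0.\<close>

lemma starlike_caratheodory:
  assumes \<alpha>: "\<alpha> < 1" and f: "f \<in> starlike_of_order \<alpha>"
  defines "F \<equiv> fps_expansion f 0"
  obtains P where "caratheodory P"
    "fps_const (of_real (1 - \<alpha>)) * ((P - 1) * F) = fps_X * fps_deriv F - F"
proof -
  have fn: "f \<in> normalized_analytic" and nz: "\<And>z. z \<in> ball 0 1 - {0} \<Longrightarrow> f z \<noteq> 0"
    and re: "\<And>z. z \<in> ball 0 1 - {0} \<Longrightarrow> Re (z * deriv f z / f z) > \<alpha>"
    using f by (auto simp: starlike_of_order_def)
  have hol: "f holomorphic_on ball 0 1" using fn by (simp add: normalized_analytic_def)
  note F = normalized_analytic_fps[OF fn, folded F_def]
  define N where "N = fps_X * fps_deriv F"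
  have N1: "N $ 0 = 0" "N $ 1 = 1" using F by (simp_all add: N_def)
  have "subdegree F = 1" "subdegree N = 1"
    using F N1 by (auto intro!: subdegreeI)
  then have sub: "subdegree F = 1" "subdegree N = 1" "F \<noteq> 0" "N \<noteq> 0" by auto
  define q where "q = (\<lambda>z. if z = 0 then 1 else z * deriv f z / f z)"
  have "(\<lambda>z. z * deriv f z) has_fps_expansion N"
    unfolding N_def by (intro fps_expansion_intros F)
  \<comment> \<open>Numerator and denominator both vanish to order one with leading coefficient 1,
    which matches \<open>q 0 = 1\<close>. The expansion gives holomorphy near 0, to be glued with
    that on the punctured disc.\<close>
  then have q: "q has_fps_expansion N / F"
    unfolding q_def using sub F(3) N1 by (intro has_fps_expansion_divide F) auto
  then obtain S where S: "open S" "0 \<in> S" "q holomorphic_on S"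
    by (rule has_fps_expansion_imp_holomorphic)
  have "q holomorphic_on ball 0 1 - {0} \<longleftrightarrow> (\<lambda>z. z * deriv f z / f z) holomorphic_on ball 0 1 - {0}"
    by (rule holomorphic_cong) (auto simp: q_def)
  also have "\<dots>"
    using nz by (intro holomorphic_intros holomorphic_on_subset[OF hol] holomorphic_on_subset[OF holomorphic_deriv[OF hol]]) auto
  finally have "q holomorphic_on (ball 0 1 - {0}) \<union> S"
    by (intro holomorphic_on_Un S) auto
  then have q_hol: "q holomorphic_on ball 0 1"
    by (rule holomorphic_on_subset) (use S in auto)
  define b where "b = complex_of_real (1 - \<alpha>)"
  have b: "b \<noteq> 0" using \<alpha> by (simp add: b_def del: of_real_diff)
  define P where "P = 1 + fps_const (1 / b) * (N / F - 1)"
  define p where "p = (\<lambda>z. 1 + 1 / b * (q z - 1))"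
  have "P $ 0 = 1"
    using has_fps_expansion_imp_0_eq_fps_nth_0[OF q] by (simp add: q_def P_def)
  moreover have "p has_fps_expansion P"
    unfolding p_def P_def by (intro fps_expansion_intros q)
  moreover have "p holomorphic_on ball 0 1"
    unfolding p_def using b by (intro holomorphic_intros q_hol)
  moreover have "0 \<le> Re (p z)" if "z \<in> ball 0 1" for z
  proof -
    have "\<alpha> < Re (q z)"
      using \<alpha> re[of z] that by (auto simp: q_def)
    then show ?thesis using \<alpha> unfolding p_def b_def Re_add_divide_of_real by (simp add: field_simps)
  qed
  ultimately have car: "caratheodory P" by (auto simp: caratheodory_def)
  \<comment> \<open>\<open>F\<close> is not a unit, so cancelling it in \<open>N / F * F\<close>
    rests on the equality of the subdegrees.\<close>
  have "F dvd N" using sub by (simp add: fps_dvd_iff)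
  then have "N = N / F * F" by simp
  then have "(N / F - 1) * F = N - F" by (simp only: left_diff_distrib mult_1)
  moreover have "fps_const b * ((P - 1) * F) = (N / F - 1) * F"
    unfolding P_def using b by (simp add: mult.assoc[symmetric])
  ultimately show ?thesis using that[OF car] by (simp only: b_def N_def)
qed

text \<open>Here the denominator f' has constant term 1 and no zeros in the disc, so the quotient is
  holomorphic at once.\<close>

lemma convex_caratheodory:
  assumes \<alpha>: "\<alpha> < 1" and f: "f \<in> convex_of_order \<alpha>"
  defines "F \<equiv> fps_expansion f 0"
  obtains P where "caratheodory P"
    "fps_const (of_real (1 - \<alpha>)) * ((P - 1) * fps_deriv F) = fps_X * fps_deriv (fps_deriv F)"
proof -
  have fn: "f \<in> normalized_analytic" and nz: "\<And>z. z \<in> ball 0 1 \<Longrightarrow> deriv f z \<noteq> 0"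
    and re: "\<And>z. z \<in> ball 0 1 \<Longrightarrow> Re (1 + z * deriv (deriv f) z / deriv f z) > \<alpha>"
    using f by (auto simp: convex_of_order_def)
  have hol: "f holomorphic_on ball 0 1" using fn by (simp add: normalized_analytic_def)
  note F = normalized_analytic_fps[OF fn, folded F_def]
  define b where "b = complex_of_real (1 - \<alpha>)"
  have b: "b \<noteq> 0" using \<alpha> by (simp add: b_def del: of_real_diff)
  define Q where "Q = fps_X * fps_deriv (fps_deriv F) / fps_deriv F"
  define q where "q = (\<lambda>z. z * deriv (deriv f) z / deriv f z)"
  have F'0: "fps_deriv F $ 0 = 1" using F by simp
  have q: "q has_fps_expansion Q"
    unfolding q_def Q_def using F'0 by (intro fps_expansion_intros F) auto
  have QF: "Q * fps_deriv F = fps_X * fps_deriv (fps_deriv F)"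
    unfolding Q_def using F'0 by (simp add: fps_divide_unit mult.assoc inverse_mult_eq_1)
  define P where "P = 1 + fps_const (1 / b) * Q"
  define p where "p = (\<lambda>z. 1 + 1 / b * q z)"
  have "P $ 0 = 1"
    using has_fps_expansion_imp_0_eq_fps_nth_0[OF q] by (simp add: q_def P_def)
  moreover have "p has_fps_expansion P"
    unfolding p_def P_def by (intro fps_expansion_intros q)
  moreover have "p holomorphic_on ball 0 1"
    unfolding p_def q_def using b nz by (intro holomorphic_intros hol) auto
  moreover have "0 \<le> Re (p z)" if "z \<in> ball 0 1" for z
  proof -
    show ?thesis using \<alpha> re[OF that] unfolding p_def b_def Re_add_divide_of_real
      by (simp add: q_def field_simps)
  qed
  ultimately have "caratheodory P" by (auto simp: caratheodory_def)
  moreover have "fps_const b * ((P - 1) * fps_deriv F) = fps_X * fps_deriv (fps_deriv F)"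
    unfolding P_def QF[symmetric] using b by (simp add: mult.assoc[symmetric])
  ultimately show ?thesis using that by (simp only: b_def)
qed

lemma bounded_turning_caratheodory:
  assumes \<alpha>: "\<alpha> < 1" and f: "f \<in> bounded_turning_of_order \<alpha>"
  defines "F \<equiv> fps_expansion f 0"
  obtains P where "caratheodory P" "fps_deriv F = 1 + fps_const (of_real (1 - \<alpha>)) * (P - 1)"
proof -
  have fn: "f \<in> normalized_analytic"
    and re: "\<And>z. z \<in> ball 0 1 \<Longrightarrow> Re (deriv f z) > \<alpha>"
    using f by (auto simp: bounded_turning_of_order_def)
  have hol: "f holomorphic_on ball 0 1" using fn by (simp add: normalized_analytic_def)
  note F = normalized_analytic_fps[OF fn, folded F_def]
  define b where "b = complex_of_real (1 - \<alpha>)"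
  have b: "b \<noteq> 0" using \<alpha> by (simp add: b_def del: of_real_diff)
  define P where "P = 1 + fps_const (1 / b) * (fps_deriv F - 1)"
  define p where "p = (\<lambda>z. 1 + 1 / b * (deriv f z - 1))"
  have "P $ 0 = 1" using F by (simp add: P_def)
  moreover have "p has_fps_expansion P"
    unfolding p_def P_def by (intro fps_expansion_intros F)
  moreover have "p holomorphic_on ball 0 1"
    unfolding p_def using b by (intro holomorphic_intros hol) auto
  moreover have "0 \<le> Re (p z)" if "z \<in> ball 0 1" for z
  proof -
    show ?thesis using \<alpha> re[OF that] unfolding p_def b_def Re_add_divide_of_real
      by (simp add: field_simps)
  qed
  ultimately have "caratheodory P" by (auto simp: caratheodory_def)
  moreover have "fps_deriv F = 1 + fps_const b * (P - 1)"
    unfolding P_def using b by (simp add: mult.assoc[symmetric])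
  ultimately show ?thesis using that by (simp only: b_def)
qed

theorem theorem1:
  fixes \<alpha> :: real and f h g :: "complex \<Rightarrow> complex"
  assumes "0 \<le> \<alpha>" and "\<alpha> < 1"
    and "f \<in> starlike_of_order \<alpha>"
    and "h \<in> convex_of_order \<alpha>"
    and "g \<in> bounded_turning_of_order \<alpha>"
  shows "norm (hankel31 f) \<le> 1 / 18 * (1 - \<alpha>)\<^sup>2 * (18 - \<alpha>)
    \<and> norm (hankel31 h) \<le> 1 / 540 * (1 - \<alpha>)\<^sup>2 * (49 - 16 * \<alpha>)
    \<and> norm (hankel31 g) \<le> 1 / 60 * (1 - \<alpha>)\<^sup>2 * (36 - 20 * \<alpha> + 5 * \<bar>1 - 4 * \<alpha>\<bar>)"
proof (intro conjI)
  have b: "0 < 1 - \<alpha>" "1 - \<alpha> \<le> 1" using assms by auto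
  have f: "f \<in> normalized_analytic" and h: "h \<in> normalized_analytic"
    using assms by (auto simp: starlike_of_order_def convex_of_order_def)
  obtain P where "caratheodory P"
    "fps_const (of_real (1 - \<alpha>)) * ((P - 1) * fps_expansion f 0) = fps_X * fps_deriv (fps_expansion f 0) - fps_expansion f 0"
    using starlike_caratheodory[OF assms(2,3)] .
  then have "norm (hankel31 f) \<le> 17 / 18 * (1 - \<alpha>)\<^sup>2"
    unfolding hankel31_eq using b normalized_analytic_fps[OF f] by (intro hankel31_starlike_fps)
  also have "\<dots> \<le> (18 - \<alpha>) / 18 * (1 - \<alpha>)\<^sup>2"
    using assms by (intro mult_right_mono) auto
  finally show "norm (hankel31 f) \<le> 1 / 18 * (1 - \<alpha>)\<^sup>2 * (18 - \<alpha>)"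
    by (simp add: mult.commute)
  obtain P where "caratheodory P"
    "fps_const (of_real (1 - \<alpha>)) * ((P - 1) * fps_deriv (fps_expansion h 0)) = fps_X * fps_deriv (fps_deriv (fps_expansion h 0))"
    using convex_caratheodory[OF assms(2,4)] .
  then have "norm (hankel31 h) \<le> (33 + 14 * (1 - \<alpha>)) / 540 * (1 - \<alpha>)\<^sup>2"
    unfolding hankel31_eq using b normalized_analytic_fps[OF h] by (intro hankel31_convex_fps)
  \<comment> \<open>The left numerator is 47 - 14 \<open>\<alpha>\<close>; the gap 2 (1 -
    \<open>\<alpha>\<close>) is nonnegative.\<close>
  also have "\<dots> \<le> (49 - 16 * \<alpha>) / 540 * (1 - \<alpha>)\<^sup>2"
    using assms by (intro mult_right_mono) auto
  finally show "norm (hankel31 h) \<le> 1 / 540 * (1 - \<alpha>)\<^sup>2 * (49 - 16 * \<alpha>)"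
    by (simp add: mult.commute)
  obtain P where "caratheodory P"
    "fps_deriv (fps_expansion g 0) = 1 + fps_const (of_real (1 - \<alpha>)) * (P - 1)"
    using bounded_turning_caratheodory[OF assms(2,5)] .
  then have "norm (hankel31 g) \<le> 31 / 60 * (1 - \<alpha>)\<^sup>2"
    unfolding hankel31_eq using b by (intro hankel31_bounded_turning_fps) auto
  \<comment> \<open>Replacing the absolute value by -(1 - 4 \<open>\<alpha>\<close>) leaves exactly
    31 in the numerator.\<close>
  also have "\<dots> \<le> (36 - 20 * \<alpha> + 5 * \<bar>1 - 4 * \<alpha>\<bar>) / 60 * (1 - \<alpha>)\<^sup>2"
    using abs_ge_minus_self[of "1 - 4 * \<alpha>"] by (intro mult_right_mono) (simp, simp)
  finally show "norm (hankel31 g) \<le> 1 / 60 * (1 - \<alpha>)\<^sup>2 * (36 - 20 * \<alpha> + 5 * \<bar>1 - 4 * \<alpha>\<bar>)"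
    by (simp add: mult.commute)
qed

end
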